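(* Let $D$ be a sequence database, let $0\le a\le b$ be integers (the gap constraint), let $\mathbf{p}$ be a pattern with $\mathrm{sup}(\mathbf{p},D)>0$, and let $\mathit{mincf}$ be a confidence threshold. Put $\mathit{minsup}=\mathrm{sup}(\mathbf{p},D)\times\mathit{mincf}$. If $\mathbf{q}$ is a pattern with $\mathrm{sup}(\mathbf{q},D)<\mathit{minsup}$, then no pattern $\mathbf{u}$ that is equal to $\mathbf{q}$ or is a superpattern of $\mathbf{q}$ yields a strong co-occurrence rule with antecedent $\mathbf{p}$; that is, whenever $\mathbf{u}=\mathbf{p}\cdot\mathbf{r}$ for some pattern $\mathbf{r}$, the rule $\mathbf{p}\to\mathbf{r}$ is not strong in $D$.
   Context: Let $\Sigma$ be a finite set of items. A sequence is a finite word $\mathbf{s}=s_1s_2\cdots s_n$ over $\Sigma$. A sequence database $D$ is a finite collection (list) of sequences $\mathbf{s}_1,\dots,\mathbf{s}_k$. Integers $0\le a\le b$ are fixed. A pattern is a nonempty word $\mathbf{p}=p_1\cdots p_m$ over $\Sigma$. An occurrence of $\mathbf{p}$ in $\mathbf{s}$ is a tuple of positions $\langle l_1,\dots,l_m\rangle$ in $\{1,\dots,n\}$ with $s_{l_j}=p_j$ for all $j$ and $a\le l_j-l_{j-1}-1\le b$ for $2\le j\le m$. Two occurrences $l,l'$ of $\mathbf{p}$ are nonoverlapping if $l_j\ne l'_j$ for every $1\le j\le m$. The support $\mathrm{sup}(\mathbf{p},\mathbf{s})$ is the number of nonoverlapping occurrences, i.e. the maximum cardinality of a set of pairwise nonoverlapping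 occurrences of $\mathbf{p}$ in $\mathbf{s}$. Also $\mathrm{sup}(\mathbf{p},D)=\sum_{i=1}^k \mathrm{sup}(\mathbf{p},\mathbf{s}_i)$. A pattern $\mathbf{q}$ is a superpattern of $\mathbf{p}$ if $\mathbf{q}$ is strictly longer than $\mathbf{p}$ and $\mathbf{p}$ is a prefix of $\mathbf{q}$. For patterns $\mathbf{p},\mathbf{r}$, $\mathbf{p}\cdot\mathbf{r}$ is their concatenation (with the same gap constraint $[a,b]$ between all consecutive items). The co-occurrence rule $\mathbf{p}\to\mathbf{r}$ has antecedent $\mathbf{p}$, consequent $\mathbf{r}$, and confidence $\mathrm{conf}(\mathbf{p}\to\mathbf{r})=\mathrm{sup}(\mathbf{p}\cdot\mathbf{r},D)/\mathrm{sup}(\mathbf{p},D)$. It is strong in $D$ if $\mathrm{conf}(\mathbf{p}\to\mathbf{r})\ge\mathit{mincf}$. *)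

theory Defs
  imports Complex_Main "HOL-Library.Sublist"
begin

definition pattern :: "'a set \<Rightarrow> 'a list \<Rightarrow> bool" where
  "pattern \<Sigma> p \<longleftrightarrow> p \<noteq> [] \<and> set p \<subseteq> \<Sigma>"

(* Lists are indexed from 0, so positions range over {0..<length s}. Gaps are computed
   in the integers, since truncated subtraction would allow decreasing positions. *)
definition occurrence :: "int \<Rightarrow> int \<Rightarrow> 'a list \<Rightarrow> 'a list \<Rightarrow> nat list \<Rightarrow> bool" where
  "occurrence a b p s l \<longleftrightarrow>
     length l = length p \<and>
     (\<forall>j<length p. l ! j < length s \<and> s ! (l ! j) = p ! j) \<and>
     (\<forall>j. 1 \<le> j \<and> j < length p \<longrightarrow>
        a \<le> int (l ! j) - int (l ! (j - 1)) - 1 \<and>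
        int (l ! j) - int (l ! (j - 1)) - 1 \<le> b)"

(* Only used for two occurrences of the same pattern, which have equal length. *)
definition nonoverlapping :: "nat list \<Rightarrow> nat list \<Rightarrow> bool" where
  "nonoverlapping l l' \<longleftrightarrow> length l = length l' \<and> (\<forall>j<length l. l ! j \<noteq> l' ! j)"

(* The maximum is over a finite nonempty set: a sequence has only finitely many
   occurrences of p, and the empty set of occurrences qualifies. *)
definition seq_support :: "int \<Rightarrow> int \<Rightarrow> 'a list \<Rightarrow> 'a list \<Rightarrow> nat" where
  "seq_support a b p s =
     Max {card X | X. X \<subseteq> {l. occurrence a b p s l} \<and> pairwise nonoverlapping X}"

definition support :: "int \<Rightarrow> int \<Rightarrow> 'a list \<Rightarrow> 'a list list \<Rightarrow> nat" where
  "support a b p D = (\<Sum>s\<leftarrow>D. seq_support a b p s)"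

definition superpattern :: "'a list \<Rightarrow> 'a list \<Rightarrow> bool" where
  "superpattern q p \<longleftrightarrow> length q > length p \<and> prefix p q"

definition conf :: "int \<Rightarrow> int \<Rightarrow> 'a list list \<Rightarrow> 'a list \<Rightarrow> 'a list \<Rightarrow> real" where
  "conf a b D p r = real (support a b (p @ r) D) / real (support a b p D)"

definition strong_rule ::
    "int \<Rightarrow> int \<Rightarrow> 'a list list \<Rightarrow> real \<Rightarrow> 'a list \<Rightarrow> 'a list \<Rightarrow> bool" where
  "strong_rule a b D mincf p r \<longleftrightarrow> conf a b D p r \<ge> mincf"

end

theory Submission
  imports Defs
begin

text \<open>Truncating occurrences of a pattern to a nonempty prefix maps a nonoverlapping set
  injectively to a nonoverlapping set, because two distinct members already differ in their first
  position. Hence support is antitone in the prefix order, so every extension of \<open>q\<close> stays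
  below \<open>minsup\<close>.\<close>

text \<open>The entries are positions below \<open>length s\<close> and their number is fixed by
  \<open>p\<close>. Finiteness is what lets \<open>Max\<close> in \<open>seq_support\<close> act as
  a true maximum.\<close>

lemma finite_occurrences: "finite {l. occurrence a b p s l}"
proof (rule finite_subset)
  show "{l. occurrence a b p s l} \<subseteq> {l. set l \<subseteq> {..<length s} \<and> length l = length p}"
    by (auto simp: occurrence_def in_set_conv_nth)
qed (simp add: finite_lists_length_eq)

lemma finite_nonoverlapping_cards:
  "finite {card X | X. X \<subseteq> {l. occurrence a b p s l} \<and> pairwise nonoverlapping X}"
  by (rule finite_subset[of _ "card ` Pow {l. occurrence a b p s l}"])
    (auto simp: finite_occurrences)

lemma card_le_seq_support:
  assumes "X \<subseteq> {l. occurrence a b p s l}" and "pairwise nonoverlapping X"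
  shows "card X \<le> seq_support a b p s"
  unfolding seq_support_def using assms by (intro Max_ge finite_nonoverlapping_cards) blast

text \<open>The empty set is always a candidate, so the maximum ranges over a nonempty finite set
  and some family realises it.\<close>

lemma seq_support_attained:
  obtains X where "X \<subseteq> {l. occurrence a b p s l}" and "pairwise nonoverlapping X"
    and "card X = seq_support a b p s"
proof -
  have "{card X | X. X \<subseteq> {l. occurrence a b p s l} \<and> pairwise nonoverlapping X} \<noteq> {}"
    using pairwise_empty by blast
  from Max_in[OF finite_nonoverlapping_cards this] show thesis
    using that unfolding seq_support_def by fastforce
qed

text \<open>Each condition involves a single index or two adjacent ones, and \<open>u\<close> agrees
  with \<open>q\<close> below \<open>length q\<close>; the conditions at those indices survive the
  cut.\<close>

lemma occurrence_take:
  assumes "prefix q u" and "occurrence a b u s l"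
  shows "occurrence a b q s (take (length q) l)"
  using assms by (auto simp: occurrence_def prefix_def nth_append split: if_splits)

lemma nonoverlapping_take:
  "nonoverlapping l l' \<Longrightarrow> nonoverlapping (take n l) (take n l')"
  by (auto simp: nonoverlapping_def)

lemma seq_support_antimono:
  assumes "q \<noteq> []" and "prefix q u"
  shows "seq_support a b u s \<le> seq_support a b q s"
proof -
  obtain X where occ: "X \<subseteq> {l. occurrence a b u s l}" and disj: "pairwise nonoverlapping X"
    and card: "card X = seq_support a b u s"
    by (rule seq_support_attained)
  let ?t = "take (length q)"
  have "inj_on ?t X"
  proof (rule inj_onI, rule ccontr)
    fix l l' assume l: "l \<in> X" "l' \<in> X" "?t l = ?t l'" "l \<noteq> l'"
    then have "nonoverlapping l l'"
      using disj by (auto simp: pairwise_def)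
    \<comment> \<open>\<open>l\<close> is as long as \<open>u\<close>, which extends the nonempty
      \<open>q\<close>. On empty lists \<open>nonoverlapping\<close> would hold vacuously and give
      no contradiction.\<close>
    moreover have "0 < length l"
      using l(1) occ assms by (auto simp: occurrence_def)
    ultimately have "l ! 0 \<noteq> l' ! 0"
      by (simp add: nonoverlapping_def)
    \<comment> \<open>Index 0 lies below \<open>length q\<close>, so equal truncations would agree
      there.\<close>
    then show False
      using l(3) assms(1) by (metis length_greater_0_conv nth_take)
  qed
  then have "seq_support a b u s = card (?t ` X)"
    by (simp add: card card_image)
  also have "\<dots> \<le> seq_support a b q s"
  proof (rule card_le_seq_support)
    show "?t ` X \<subseteq> {l. occurrence a b q s l}"
      using occ occurrence_take[OF assms(2)] by blast
    \<comment> \<open>Distinct truncations come from distinct members of \<open>X\<close>, to which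
      \<open>disj\<close> applies.\<close>
    show "pairwise nonoverlapping (?t ` X)"
      using disj by (auto simp: pairwise_def intro!: nonoverlapping_take)
  qed
  finally show ?thesis .
qed

lemma support_antimono:
  assumes "q \<noteq> []" and "prefix q u"
  shows "support a b u D \<le> support a b q D"
  unfolding support_def by (intro sum_list_mono seq_support_antimono assms)

theorem theorem3:
  fixes \<Sigma> :: "'a set" and D :: "'a list list" and a b :: int
    and p q :: "'a list" and mincf minsup :: real
  assumes "finite \<Sigma>"
    and "\<forall>s\<in>set D. set s \<subseteq> \<Sigma>"
    and "0 \<le> a" and "a \<le> b"
    and "pattern \<Sigma> p" and "support a b p D > 0"
    and "minsup = real (support a b p D) * mincf"
    and "pattern \<Sigma> q" and "real (support a b q D) < minsup"
  shows "\<forall>u. pattern \<Sigma> u \<and> (u = q \<or> superpattern u q) \<longrightarrow>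
           (\<forall>r. pattern \<Sigma> r \<and> u = p @ r \<longrightarrow> \<not> strong_rule a b D mincf p r)"
proof (intro allI impI)
  fix u r
  assume u: "pattern \<Sigma> u \<and> (u = q \<or> superpattern u q)" and r: "pattern \<Sigma> r \<and> u = p @ r"
  have "q \<noteq> []" and "prefix q u"
    using assms(8) u by (auto simp: pattern_def superpattern_def)
  \<comment> \<open>The numerator of the confidence is the support of \<open>u\<close> itself, an
    extension of \<open>q\<close>.\<close>
  then have "support a b (p @ r) D \<le> support a b q D"
    using r support_antimono by blast
  then have "real (support a b (p @ r) D) < mincf * real (support a b p D)"
    using assms(7,9) by (simp add: mult.commute)
  \<comment> \<open>Dividing by the positive support of \<open>p\<close> keeps the inequality
    strict.\<close>
  then show "\<not> strong_rule a b D mincf p r"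
    using assms(6) by (simp add: strong_rule_def conf_def not_le pos_divide_less_eq)
qed

end
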